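(* Let $P=(X,\prec)$ be a finite poset and let $x\in X$. Then for every positive integer $a$ there exists an integer $T(P,x,a)>0$ such that for all $t>T(P,x,a)$, $$\Omega(P,t;x,a)^2\ \ge\ \Omega(P,t;x,a+1)\cdot\Omega(P,t;x,a-1).$$
   Context: For an integer $t\ge1$ and integer $a$, $\Omega(P,t;x,a)$ is the number of maps $g:X\to[t]$ with $g(u)\le g(v)$ whenever $u\prec v$, and $g(x)=a$. *)

theory Defs
  imports Main "HOL-Library.FuncSet"
begin

definition strict_poset :: "'a set \<Rightarrow> ('a \<Rightarrow> 'a \<Rightarrow> bool) \<Rightarrow> bool" where
  "strict_poset X prec \<longleftrightarrow> irreflp_on X prec \<and> transp_on X prec"

text \<open>Maps are taken extensional on the carrier, so that maps differing only outside
  \<open>X\<close> are counted once. For \<open>a\<close> outside \<open>{1..t}\<close> (in particular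
  \<open>a = 0\<close>) and \<open>x \<in> X\<close> the count is \<open>0\<close>.\<close>

definition order_preserving_maps ::
    "'a set \<Rightarrow> ('a \<Rightarrow> 'a \<Rightarrow> bool) \<Rightarrow> int \<Rightarrow> ('a \<Rightarrow> int) set" where
  "order_preserving_maps X prec t =
     {g \<in> X \<rightarrow>\<^sub>E {1..t}. \<forall>u\<in>X. \<forall>v\<in>X. prec u v \<longrightarrow> g u \<le> g v}"

definition Omega ::
    "'a set \<Rightarrow> ('a \<Rightarrow> 'a \<Rightarrow> bool) \<Rightarrow> int \<Rightarrow> 'a \<Rightarrow> int \<Rightarrow> nat" where
  "Omega X prec t x a = card {g \<in> order_preserving_maps X prec t. g x = a}"

end

theory Submission
  imports Defs
begin

text \<open>
  For order preserving \<open>f\<close>, \<open>g\<close> with \<open>f x = a + 1\<close>, \<open>g x = a - 1\<close>, the maps \<open>max (f - 1) g\<close> and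
  \<open>min f (g + 1)\<close> are order preserving with values in \<open>{1..t}\<close>, and both send \<open>x\<close> to \<open>a\<close>. They are
  join and, up to a shift by one, meet of \<open>f - 1\<close> and \<open>g\<close> in a product of chains, so the inequality,
  for every \<open>t\<close>, is an instance of Daykin's inequality for distributive lattices: the cardinalities
  of two sets have a product at most that of the cardinalities of their sets of joins and of meets.
  The latter follows from the Ahlswede--Daykin four functions theorem.
\<close>

text \<open>The case of a one-element ground set: index 1 means that the set contains the element.
  Both mixed products \<open>p\<close>, \<open>q\<close> are at most \<open>m\<close>, and
  \<open>p * q\<close> is at most \<open>m * (c0 * d1)\<close>; this bounds their sum by
  \<open>m + c0 * d1\<close>.\<close>

lemma four_functions_one_point:
  fixes a0 a1 b0 b1 c0 c1 d0 d1 :: "'b::linordered_idom"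
  assumes nonneg: "0 \<le> a0" "0 \<le> a1" "0 \<le> b0" "0 \<le> b1" "0 \<le> c0" "0 \<le> c1" "0 \<le> d0" "0 \<le> d1"
    and le: "a0 * b0 \<le> c0 * d0" "a0 * b1 \<le> c1 * d0" "a1 * b0 \<le> c1 * d0" "a1 * b1 \<le> c1 * d1"
  shows "(a0 + a1) * (b0 + b1) \<le> (c0 + c1) * (d0 + d1)"
proof -
  define m where "m = c1 * d0"
  define p where "p = a0 * b1"
  define q where "q = a1 * b0"
  have pq: "0 \<le> p" "0 \<le> q" "p \<le> m" "q \<le> m"
    using nonneg le by (auto simp: p_def q_def m_def)
  have "p + q \<le> m + c0 * d1"
  proof (cases "m = 0")
    case True
    then show ?thesis using pq nonneg by auto
  next
    case False
    then have "m > 0" using pq by auto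
    have "p * q = (a0 * b0) * (a1 * b1)"
      by (simp add: p_def q_def algebra_simps)
    also have "\<dots> \<le> (c0 * d0) * (c1 * d1)"
      using nonneg by (intro mult_mono[OF le(1,4)]) auto
    also have "\<dots> = m * (c0 * d1)"
      by (simp add: m_def algebra_simps)
    finally have "p * q \<le> m * (c0 * d1)" .
    \<comment> \<open>Expanded, this reads \<open>m * (p + q)\<close> \<le>
      \<open>m * m + p * q\<close>; the common factor \<open>m\<close> is cancelled
      afterwards.\<close>
    moreover have "0 \<le> (m - p) * (m - q)"
      using pq by simp
    ultimately have "m * (p + q) \<le> m * (m + c0 * d1)"
      by (simp add: algebra_simps)
    then show ?thesis
      using \<open>m > 0\<close> by simp
  qed
  then show ?thesis
    using le(1,4) by (simp add: p_def q_def m_def algebra_simps)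
qed

lemma sum_Pow_insert:
  assumes "finite S" "s \<notin> S"
  shows "sum f (Pow (insert s S)) = (\<Sum>A\<in>Pow S. f A + f (insert s A))"
proof -
  have "inj_on (insert s) (Pow S)"
    using assms(2) by (auto simp: inj_on_def)
  moreover have "Pow S \<inter> insert s ` Pow S = {}"
    using assms(2) by auto
  ultimately show ?thesis
    using assms(1) by (simp add: Pow_insert sum.union_disjoint sum.reindex sum.distrib)
qed

text \<open>Induction on \<open>S\<close>: summing out the new element \<open>s\<close> turns each
  function into one on \<open>Pow S\<close>, and the one-point case shows that the hypothesis
  survives.\<close>

theorem four_functions:
  fixes \<alpha> \<beta> \<gamma> \<delta> :: "'a set \<Rightarrow> 'b::linordered_idom"
  assumes "finite S"
    and "\<And>A. A \<subseteq> S \<Longrightarrow> 0 \<le> \<alpha> A \<and> 0 \<le> \<beta> A \<and> 0 \<le> \<gamma> A \<and> 0 \<le> \<delta> A"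
    and "\<And>A B. A \<subseteq> S \<Longrightarrow> B \<subseteq> S \<Longrightarrow> \<alpha> A * \<beta> B \<le> \<gamma> (A \<union> B) * \<delta> (A \<inter> B)"
  shows "sum \<alpha> (Pow S) * sum \<beta> (Pow S) \<le> sum \<gamma> (Pow S) * sum \<delta> (Pow S)"
  using assms
proof (induction S arbitrary: \<alpha> \<beta> \<gamma> \<delta> rule: finite_induct)
  case empty
  from empty(2)[of "{}" "{}"] show ?case by simp
next
  case (insert s S)
  note nonneg = insert.prems(1) and le = insert.prems(2)
  let ?ext = "\<lambda>f A. f A + f (insert s A)"
  have "sum (?ext \<alpha>) (Pow S) * sum (?ext \<beta>) (Pow S) \<le> sum (?ext \<gamma>) (Pow S) * sum (?ext \<delta>) (Pow S)"
  proof (rule insert.IH)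
    fix A assume "A \<subseteq> S"
    then have "A \<subseteq> insert s S" "insert s A \<subseteq> insert s S" by auto
    then show "0 \<le> ?ext \<alpha> A \<and> 0 \<le> ?ext \<beta> A \<and> 0 \<le> ?ext \<gamma> A \<and> 0 \<le> ?ext \<delta> A"
      using nonneg by (simp add: add_nonneg_nonneg)
  next
    fix A B assume AB: "A \<subseteq> S" "B \<subseteq> S"
    then have sub: "A \<subseteq> insert s S" "insert s A \<subseteq> insert s S"
        "B \<subseteq> insert s S" "insert s B \<subseteq> insert s S"
        "A \<union> B \<subseteq> insert s S" "insert s (A \<union> B) \<subseteq> insert s S"
        "A \<inter> B \<subseteq> insert s S" "insert s (A \<inter> B) \<subseteq> insert s S"
      by auto
    \<comment> \<open>When only one of the two sets receives \<open>s\<close>, the union contains it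
      and the intersection does not, which is the pattern \<open>c1 * d0\<close> of the mixed
      terms.\<close>
    have "s \<notin> A" "s \<notin> B" using AB insert.hyps by auto
    then have "A \<inter> insert s B = A \<inter> B" "insert s A \<inter> B = A \<inter> B"
        "insert s A \<inter> insert s B = insert s (A \<inter> B)"
      by auto
    then show "?ext \<alpha> A * ?ext \<beta> B \<le> ?ext \<gamma> (A \<union> B) * ?ext \<delta> (A \<inter> B)"
      using nonneg sub le[OF sub(1) sub(3)] le[OF sub(1) sub(4)] le[OF sub(2) sub(3)]
        le[OF sub(2) sub(4)]
      by (intro four_functions_one_point) auto
  qed
  then show ?case
    using insert.hyps by (simp add: sum_Pow_insert)
qed

text \<open>The four functions are the indicators of \<A>, \<B>, the unions and the
  intersections.\<close>

corollary card_mult_le_card_unions_mult_card_inters: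
  assumes "finite S" "\<A> \<subseteq> Pow S" "\<B> \<subseteq> Pow S"
  shows "card \<A> * card \<B> \<le>
    card {A \<union> B |A B. A \<in> \<A> \<and> B \<in> \<B>} * card {A \<inter> B |A B. A \<in> \<A> \<and> B \<in> \<B>}"
proof -
  define \<U> where "\<U> = {A \<union> B |A B. A \<in> \<A> \<and> B \<in> \<B>}"
  define \<I> where "\<I> = {A \<inter> B |A B. A \<in> \<A> \<and> B \<in> \<B>}"
  have sub: "\<U> \<subseteq> Pow S" "\<I> \<subseteq> Pow S"
    using assms(2,3) by (auto simp: \<U>_def \<I>_def)
  have card_eq: "(\<Sum>A\<in>Pow S. of_bool (A \<in> \<F>)) = int (card \<F>)" if "\<F> \<subseteq> Pow S" for \<F>
    using that assms(1) by (simp add: of_bool_def sum.If_cases inf.absorb2)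
  have "(\<Sum>A\<in>Pow S. of_bool (A \<in> \<A>)) * (\<Sum>A\<in>Pow S. of_bool (A \<in> \<B>)) \<le>
      (\<Sum>A\<in>Pow S. of_bool (A \<in> \<U>)) * (\<Sum>A\<in>Pow S. of_bool (A \<in> \<I>) :: int)"
    using assms(1) by (rule four_functions) (auto simp: of_bool_def \<U>_def \<I>_def)
  then have "int (card \<A> * card \<B>) \<le> int (card \<U> * card \<I>)"
    using assms(2,3) sub by (simp add: card_eq)
  then show ?thesis
    by (simp only: of_nat_le_iff \<U>_def \<I>_def)
qed

text \<open>A map \<open>h\<close> with values in \<open>{k..t}\<close> is identified with the region between the constant map
  \<open>k\<close> and \<open>h\<close>, so that pointwise \<open>max\<close> and \<open>min\<close> become union and intersection.\<close>

lemma inj_on_region: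
  fixes k :: int
  shows "inj_on (\<lambda>h. SIGMA u:X. {1..h u - k}) (X \<rightarrow>\<^sub>E {k..})"
proof (rule inj_onI)
  fix g h assume g: "g \<in> X \<rightarrow>\<^sub>E {k..}" and h: "h \<in> X \<rightarrow>\<^sub>E {k..}"
    and eq: "(SIGMA u:X. {1..g u - k}) = (SIGMA u:X. {1..h u - k})"
  show "g = h"
  proof (rule PiE_ext[OF g h])
    fix u assume u: "u \<in> X"
    then have "{1..g u - k} = {1..h u - k}"
      using eq by blast
    \<comment> \<open>Equal intervals may both be empty; the lower bound \<open>k\<close> then
      forces both values to be \<open>k\<close>.\<close>
    moreover have "g u \<ge> k" "h u \<ge> k"
      using g h u by auto
    ultimately show "g u = h u"
      by (auto simp: Icc_eq_Icc)
  qed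
qed

lemma Omega_log_concave:
  assumes "finite X" "x \<in> X"
  shows "Omega X prec t x (a + 1) * Omega X prec t x (a - 1) \<le> (Omega X prec t x a)\<^sup>2"
proof -
  define M where "M b = {g \<in> order_preserving_maps X prec t. g x = b}" for b
  \<comment> \<open>\<open>R 1 f\<close> is the region of \<open>f - 1\<close> above 0, so the shift
    by one is absorbed into \<open>k\<close>. As values are at least 1, both \<open>k = 0\<close>
    and \<open>k = 1\<close> keep \<open>R k\<close> injective.\<close>
  define R where "R k h = (SIGMA u:X. {1..h u - k})" for k :: int and h :: "'a \<Rightarrow> int"
  have M_PiE: "M b \<subseteq> X \<rightarrow>\<^sub>E {1..t}" for b
    by (auto simp: M_def order_preserving_maps_def)
  have M_mono: "g u \<le> g v" if "g \<in> M b" "u \<in> X" "v \<in> X" "prec u v" for g b u v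
    using that by (simp add: M_def order_preserving_maps_def)
  have finite_M: "finite (M b)" for b
    using finite_subset[OF M_PiE] assms(1) by (simp add: finite_PiE)
  have card_R: "card (R k ` M b) = card (M b)" if "k \<le> 1" for k b
  proof (rule card_image)
    have "M b \<subseteq> X \<rightarrow>\<^sub>E {k..}"
      using M_PiE that by (force simp: PiE_iff)
    then show "inj_on (R k) (M b)"
      using inj_on_region inj_on_subset unfolding R_def by blast
  qed
  define S where "S = X \<times> {1..t}"
  have R_sub: "R k ` M b \<subseteq> Pow S" if "k \<ge> 0" for k b
    using M_PiE[of b] that by (fastforce simp: R_def S_def PiE_iff)
  have unions: "{A \<union> B |A B. A \<in> R 1 ` M (a + 1) \<and> B \<in> R 0 ` M (a - 1)} \<subseteq> R 0 ` M a"
  proof clarify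
    fix f g assume f: "f \<in> M (a + 1)" and g: "g \<in> M (a - 1)"
    \<comment> \<open>The lower bound 1 comes from \<open>g\<close>; at \<open>x\<close> the maximum
      is that of \<open>a\<close> and \<open>a - 1\<close>.\<close>
    let ?h = "\<lambda>u\<in>X. max (f u - 1) (g u)"
    have range: "f u \<in> {1..t}" "g u \<in> {1..t}" if "u \<in> X" for u
      using M_PiE f g that by blast+
    have "?h \<in> order_preserving_maps X prec t"
      using range M_mono[OF f] M_mono[OF g]
      by (force simp: order_preserving_maps_def PiE_iff le_max_iff_disj)
    moreover have "?h x = a"
      using f g assms(2) by (simp add: M_def)
    moreover have "R 1 f \<union> R 0 g = R 0 ?h"
      by (auto simp: R_def)
    ultimately show "R 1 f \<union> R 0 g \<in> R 0 ` M a"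
      by (auto simp: M_def)
  qed
  have inters: "{A \<inter> B |A B. A \<in> R 1 ` M (a + 1) \<and> B \<in> R 0 ` M (a - 1)} \<subseteq> R 1 ` M a"
  proof clarify
    fix f g assume f: "f \<in> M (a + 1)" and g: "g \<in> M (a - 1)"
    \<comment> \<open>The meet of \<open>f - 1\<close> and \<open>g\<close> may take the value 0;
      raising it by one restores the range \<open>{1..t}\<close>, and \<open>R 1\<close> undoes the
      shift.\<close>
    let ?h = "\<lambda>u\<in>X. min (f u) (g u + 1)"
    have range: "f u \<in> {1..t}" "g u \<in> {1..t}" if "u \<in> X" for u
      using M_PiE f g that by blast+
    have "?h \<in> order_preserving_maps X prec t"
      using range M_mono[OF f] M_mono[OF g]
      by (force simp: order_preserving_maps_def PiE_iff min_le_iff_disj)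
    moreover have "?h x = a"
      using f g assms(2) by (simp add: M_def)
    moreover have "R 1 f \<inter> R 0 g = R 1 ?h"
      by (auto simp: R_def)
    ultimately show "R 1 f \<inter> R 0 g \<in> R 1 ` M a"
      by (auto simp: M_def)
  qed
  have "card (M (a + 1)) * card (M (a - 1)) = card (R 1 ` M (a + 1)) * card (R 0 ` M (a - 1))"
    by (simp add: card_R)
  also have "\<dots> \<le> card {A \<union> B |A B. A \<in> R 1 ` M (a + 1) \<and> B \<in> R 0 ` M (a - 1)} *
      card {A \<inter> B |A B. A \<in> R 1 ` M (a + 1) \<and> B \<in> R 0 ` M (a - 1)}"
    using R_sub assms(1)
    by (intro card_mult_le_card_unions_mult_card_inters[of S]) (auto simp: S_def)
  also have "\<dots> \<le> card (R 0 ` M a) * card (R 1 ` M a)"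
    using unions inters finite_M by (intro mult_le_mono card_mono) auto
  also have "\<dots> = (card (M a))\<^sup>2"
    by (simp add: card_R power2_eq_square)
  finally show ?thesis
    by (simp add: Omega_def M_def)
qed

theorem theorem4p20:
  fixes X :: "'a set" and prec :: "'a \<Rightarrow> 'a \<Rightarrow> bool" and x :: 'a and a :: int
  assumes "finite X" and "strict_poset X prec" and "x \<in> X" and "a > 0"
  shows "\<exists>T::int. T > 0 \<and> (\<forall>t::int. t > T \<longrightarrow>
           (Omega X prec t x a)\<^sup>2 \<ge> Omega X prec t x (a + 1) * Omega X prec t x (a - 1))"
  \<comment> \<open>The inequality holds for every \<open>t\<close>, so any positive threshold
    serves.\<close>
  using Omega_log_concave[OF assms(1,3)] by (intro exI[of _ 1]) simp

end
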